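(* Let $K \geq 1$ be an integer and $n \geq 1$ an integer. Let $\mathbf{A}_1, \mathbf{B}_1$ be any positive definite $n \times n$ complex matrices and, for all $k \in \{2,\dots,K\}$, let $\mathbf{A}_k, \mathbf{B}_k$ be any positive semidefinite $n \times n$ complex matrices. Then $$\mathrm{Tr}\left\{ \sum_{k=1}^K (\mathbf{A}_k-\mathbf{B}_k)\left[\left(\sum_{\ell=1}^k \mathbf{B}_\ell\right)^{-1} - \left(\sum_{\ell=1}^k \mathbf{A}_\ell\right)^{-1}\right]\right\} \geq 0 .$$ In particular, this trace is a real number.
   Context: $\mathrm{Tr}(\cdot)$ denotes the matrix trace. Positive definite and positive semidefinite matrices are understood to be Hermitian (complex entries allowed), and all matrices have the same size $n \times n$. *)

theory Defs
  imports "HOL-Analysis.Analysis"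
begin

definition conj_transpose :: "complex ^ 'n ^ 'm \<Rightarrow> complex ^ 'm ^ 'n" where
  "conj_transpose M = (\<chi> i j. cnj (M $ j $ i))"

definition hermitian :: "complex ^ 'n ^ 'n \<Rightarrow> bool" where
  "hermitian M \<longleftrightarrow> conj_transpose M = M"

text \<open>The Hermitian form \<open>x\<^sup>* M x\<close>. The inner product of the library on \<open>complex ^ 'n\<close>
  is real-valued, so the form is written out.\<close>

definition herm_form :: "complex ^ 'n ^ 'n \<Rightarrow> complex ^ 'n \<Rightarrow> complex" where
  "herm_form M x = (\<Sum>i\<in>UNIV. cnj (x $ i) * (M *v x) $ i)"

text \<open>For Hermitian \<open>M\<close> the value \<open>herm_form M x\<close> is real, so its real part carries the sign.\<close>

definition pos_semidef :: "complex ^ 'n ^ 'n \<Rightarrow> bool" where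
  "pos_semidef M \<longleftrightarrow> hermitian M \<and> (\<forall>x. 0 \<le> Re (herm_form M x))"

definition pos_def :: "complex ^ 'n ^ 'n \<Rightarrow> bool" where
  "pos_def M \<longleftrightarrow> hermitian M \<and> (\<forall>x. x \<noteq> 0 \<longrightarrow> 0 < Re (herm_form M x))"

end

theory Submission
  imports Defs
begin

text \<open>Write \<open>X\<^sub>k\<close>, \<open>Y\<^sub>k\<close> for the partial sums of the \<open>A\<^sub>l\<close>, \<open>B\<^sub>l\<close>, put \<open>D\<^sub>k = X\<^sub>k - Y\<^sub>k\<close>, and let
  \<open>\<langle>P, Q\<rangle>\<^sub>k = Tr (P Y\<^sub>k\<inverse> Q X\<^sub>k\<inverse>)\<close>, a positive semidefinite form on Hermitian matrices. Since
  \<open>Y\<inverse> - X\<inverse> = Y\<inverse> (X - Y) X\<inverse>\<close>, the \<open>k\<close>-th term is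
  \<open>\<langle>D\<^sub>k, D\<^sub>k\<rangle>\<^sub>k - \<langle>D\<^sub>k\<^sub>-\<^sub>1, D\<^sub>k\<rangle>\<^sub>k\<close>, whose real part is at least
  \<open>(\<langle>D\<^sub>k, D\<^sub>k\<rangle>\<^sub>k - \<langle>D\<^sub>k\<^sub>-\<^sub>1, D\<^sub>k\<^sub>-\<^sub>1\<rangle>\<^sub>k) / 2\<close> by Cauchy--Schwarz. As inversion reverses the Loewner order,
  \<open>\<langle>P, P\<rangle>\<^sub>k\<close> decreases in \<open>k\<close>, so these bounds telescope and the whole sum is at least
  \<open>\<langle>D\<^sub>K, D\<^sub>K\<rangle>\<^sub>K / 2 \<ge> 0\<close>.\<close>

section \<open>Complex inner product and Hermitian matrices\<close>

definition cip :: "complex ^ 'n \<Rightarrow> complex ^ 'n \<Rightarrow> complex" where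
  "cip x y = (\<Sum>i\<in>UNIV. cnj (x $ i) * y $ i)"

lemma herm_form_cip: "herm_form M x = cip x (M *v x)"
  by (simp add: herm_form_def cip_def)

lemma cip_add_right: "cip z (x + y) = cip z x + cip z y"
  by (simp add: cip_def algebra_simps sum.distrib)

lemma cip_diff_left: "cip (x - y) z = cip x z - cip y z"
  by (simp add: cip_def algebra_simps sum_subtractf)

lemma cip_diff_right: "cip z (x - y) = cip z x - cip z y"
  by (simp add: cip_def algebra_simps sum_subtractf)

lemma cip_scale_left: "cip (c *s x) y = cnj c * cip x y"
  by (simp add: cip_def sum_distrib_left algebra_simps)

lemma cip_scale_right: "cip x (c *s y) = c * cip x y"
  by (simp add: cip_def sum_distrib_left algebra_simps)

lemma matrix_vector_mult_axis: "(M :: complex ^ 'n ^ 'm) *v axis i 1 = column i M"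
  by (simp add: vec_eq_iff matrix_vector_mult_def column_def axis_def if_distrib[of "\<lambda>z. _ * z"]
      cong: if_cong)

lemma cip_axis_left: "cip (axis i 1) y = y $ i"
  by (simp add: cip_def axis_def if_distrib[of cnj] if_distrib[of "\<lambda>z. z * _"] cong: if_cong)

lemma cnj_cip: "cnj (cip x y) = cip y x"
  by (simp add: cip_def mult.commute)

lemma cip_adjoint: "cip x (M *v y) = cip (conj_transpose M *v x) y"
proof -
  have "cip x (M *v y) = (\<Sum>i\<in>UNIV. \<Sum>j\<in>UNIV. cnj (x $ i) * (M $ i $ j * y $ j))"
    by (simp add: cip_def matrix_vector_mult_def sum_distrib_left)
  also have "\<dots> = (\<Sum>j\<in>UNIV. \<Sum>i\<in>UNIV. cnj (x $ i) * (M $ i $ j * y $ j))"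
    by (rule sum.swap)
  also have "\<dots> = cip (conj_transpose M *v x) y"
    by (simp add: cip_def matrix_vector_mult_def conj_transpose_def sum_distrib_left sum_distrib_right ac_simps)
  finally show ?thesis .
qed

lemma cip_hermitian: "hermitian M \<Longrightarrow> cip x (M *v y) = cip (M *v x) y"
  by (simp add: cip_adjoint hermitian_def)

lemma conj_transpose_mult: "conj_transpose (M ** N) = conj_transpose N ** conj_transpose M"
  by (simp add: conj_transpose_def matrix_matrix_mult_def vec_eq_iff mult.commute)

lemma conj_transpose_mat_1 [simp]: "conj_transpose (mat 1) = mat 1"
  by (auto simp: conj_transpose_def mat_def vec_eq_iff)

lemma hermitian_entry: "hermitian M \<Longrightarrow> cnj (M $ i $ j) = M $ j $ i"
  unfolding hermitian_def conj_transpose_def vec_eq_iff by simp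

lemma hermitian_add: "hermitian M \<Longrightarrow> hermitian N \<Longrightarrow> hermitian (M + N)"
  by (simp add: hermitian_def conj_transpose_def vec_eq_iff)

lemma hermitian_diff: "hermitian M \<Longrightarrow> hermitian N \<Longrightarrow> hermitian (M - N)"
  by (simp add: hermitian_def conj_transpose_def vec_eq_iff)

lemma trace_conj_transpose: "trace (conj_transpose M) = cnj (trace M)"
  by (simp add: trace_def conj_transpose_def)

lemma trace_hermitian_mult_real:
  assumes "hermitian M" "hermitian N"
  shows "trace (M ** N) \<in> \<real>"
proof -
  have "cnj (trace (M ** N)) = trace (N ** M)"
    using assms by (simp add: trace_conj_transpose[symmetric] conj_transpose_mult hermitian_def)
  also have "\<dots> = trace (M ** N)"
    by (rule trace_mul_sym)
  finally show ?thesis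
    by (simp add: Reals_cnj_iff)
qed

lemma pos_semidef_column_bound:
  assumes "pos_semidef P"
  shows "0 \<le> Re (herm_form P x) - 2 * t * (cmod ((P *v x) $ i))\<^sup>2
              + t\<^sup>2 * (cmod ((P *v x) $ i))\<^sup>2 * Re (P $ i $ i)"
proof -
  define r where "r = (P *v x) $ i"
  define e :: "complex ^ 'a" where "e = axis i 1"
  \<comment> \<open>The bound is nonnegativity of the form at \<open>x - c *s e\<close>; this
    \<open>c\<close> turns both cross terms into \<open>t * |r|^2\<close>. The real \<open>t\<close>
    stays free because two values are needed later: a large one when the diagonal entry vanishes,
    and its reciprocal otherwise.\<close>
  define c where "c = of_real t * r"
  have herm: "hermitian P" using assms by (simp add: pos_semidef_def)
  have ex: "cip e (P *v x) = r"
    by (simp add: e_def cip_axis_left r_def)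
  have xe: "cip x (P *v e) = cnj r"
    by (metis cip_hermitian cnj_cip ex herm)
  have ee: "cip e (P *v e) = P $ i $ i"
    by (simp add: e_def cip_axis_left matrix_vector_mult_axis column_def)
  have rr: "r * cnj r = of_real ((cmod r)\<^sup>2)"
    by (rule complex_norm_square[symmetric])
  have cr: "cnj c * r = of_real (t * (cmod r)\<^sup>2)" "c * cnj r = of_real (t * (cmod r)\<^sup>2)"
    "cnj c * c = of_real (t\<^sup>2 * (cmod r)\<^sup>2)"
    using rr by (simp_all add: c_def power2_eq_square ac_simps)
  have "herm_form P (x - c *s e) = cip x (P *v x) - cnj c * r - c * cnj r + cnj c * c * P $ i $ i"
    by (simp add: herm_form_cip matrix_vector_mult_diff_distrib vector_scalar_commute
        cip_diff_left cip_diff_right cip_scale_left cip_scale_right ex xe ee algebra_simps)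
  also have "\<dots> = herm_form P x - of_real (2 * t * (cmod r)\<^sup>2) + of_real (t\<^sup>2 * (cmod r)\<^sup>2) * P $ i $ i"
    by (simp add: cr herm_form_cip)
  finally have "Re (herm_form P (x - c *s e)) =
     Re (herm_form P x) - 2 * t * (cmod r)\<^sup>2 + t\<^sup>2 * (cmod r)\<^sup>2 * Re (P $ i $ i)"
    by (simp add: del: of_real_mult of_real_power)
  then show ?thesis
    using assms unfolding pos_semidef_def r_def by metis
qed

section \<open>Elimination and traces of products of positive semidefinite matrices\<close>

lemma pos_semidef_diag:
  assumes "pos_semidef P"
  shows "P $ i $ i \<in> \<real>" and "0 \<le> Re (P $ i $ i)"
proof -
  show "P $ i $ i \<in> \<real>"
    using assms by (metis Reals_cnj_iff hermitian_entry pos_semidef_def)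
  have "herm_form P (axis i 1) = P $ i $ i"
    by (simp add: herm_form_cip cip_axis_left matrix_vector_mult_axis column_def)
  then show "0 \<le> Re (P $ i $ i)"
    using assms by (metis pos_semidef_def)
qed

lemma pos_semidef_zero_diag:
  assumes "pos_semidef P" "P $ i $ i = 0"
  shows "P $ i $ j = 0"
proof (rule ccontr)
  assume "P $ i $ j \<noteq> 0"
  moreover have "(P *v axis j 1) $ i = P $ i $ j"
    by (simp add: matrix_vector_mult_axis column_def)
  ultimately have r: "0 < (cmod ((P *v axis j 1) $ i))\<^sup>2"
    by simp
  \<comment> \<open>With a zero diagonal entry the column bound is affine in \<open>t\<close> with
    negative slope. Writing h for the form at \<open>axis j 1\<close>, this \<open>t\<close> makes
    it h - 2(h + 1) < 0.\<close>
  define t where "t = (Re (herm_form P (axis j 1)) + 1) / (cmod ((P *v axis j 1) $ i))\<^sup>2"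
  have "t * (cmod ((P *v axis j 1) $ i))\<^sup>2 = Re (herm_form P (axis j 1)) + 1"
    using r by (simp add: t_def)
  moreover have "0 \<le> Re (herm_form P (axis j 1))"
    using assms by (simp add: pos_semidef_def)
  ultimately show False
    using pos_semidef_column_bound[OF assms(1), of "axis j 1" t i] assms(2) by simp
qed

text \<open>The rank-one correction is one step of the outer-product Cholesky elimination.\<close>

lemma pos_semidef_schur_complement:
  assumes "pos_semidef P" "P $ i $ i \<noteq> 0"
  shows "pos_semidef (\<chi> a b. P $ a $ b - P $ a $ i * P $ i $ b / P $ i $ i)"
    (is "pos_semidef ?P'")
proof -
  have herm: "hermitian P" using assms by (simp add: pos_semidef_def)
  obtain p where p: "P $ i $ i = of_real p"
    using pos_semidef_diag(1)[OF assms(1)] by (auto elim: Reals_cases)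
  then have "p \<noteq> 0" using assms by simp
  have "0 \<le> Re (herm_form ?P' x)" for x
  proof -
    have vec: "?P' *v x = P *v x - ((P *v x) $ i / p) *s column i P"
      by (simp add: vec_eq_iff matrix_vector_mult_def column_def p sum_subtractf algebra_simps
          sum_distrib_left sum_divide_distrib)
    have "cip x (column i P) = cip x (P *v axis i 1)"
      by (simp add: matrix_vector_mult_axis)
    also have "\<dots> = cnj ((P *v x) $ i)"
      by (metis cip_axis_left cip_hermitian cnj_cip herm)
    finally have "herm_form ?P' x = herm_form P x - of_real ((cmod ((P *v x) $ i))\<^sup>2 / p)"
      by (simp add: herm_form_cip vec cip_diff_right cip_scale_right complex_norm_square del: of_real_power)
    then have "Re (herm_form ?P' x) = Re (herm_form P x) - (cmod ((P *v x) $ i))\<^sup>2 / p"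
      by (simp del: of_real_divide of_real_power)
    \<comment> \<open>Completing the square: t = 1/p is where -2t + t^2 p equals -1/p, so the column
      bound applies.\<close>
    also have "\<dots> = Re (herm_form P x) - 2 * (1 / p) * (cmod ((P *v x) $ i))\<^sup>2
              + (1 / p)\<^sup>2 * (cmod ((P *v x) $ i))\<^sup>2 * Re (P $ i $ i)"
      using \<open>p \<noteq> 0\<close> by (simp add: p field_simps power2_eq_square)
    also have "\<dots> \<ge> 0"
      by (rule pos_semidef_column_bound[OF assms(1)])
    finally show ?thesis .
  qed
  moreover have "hermitian ?P'"
    by (simp add: hermitian_def conj_transpose_def vec_eq_iff hermitian_entry[OF herm] mult.commute)
  ultimately show ?thesis
    by (simp add: pos_semidef_def)
qed

lemma trace_mult: "trace (P ** Q) = (\<Sum>a\<in>UNIV. \<Sum>b\<in>UNIV. P $ a $ b * Q $ b $ a)"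
  by (simp add: trace_def matrix_matrix_mult_def)

lemma trace_pos_semidef_mult_nonneg_support:
  assumes "finite S" "pos_semidef Q" "pos_semidef P"
    and "\<And>a b. a \<notin> S \<Longrightarrow> P $ a $ b = 0"
  shows "0 \<le> Re (trace (P ** Q))"
  using assms(1,3,4)
proof (induction S arbitrary: P rule: finite_induct)
  case empty
  then show ?case by (simp add: trace_mult)
next
  case (insert i S)
  show ?case
  proof (cases "P $ i $ i = 0")
    case True
    then have "\<And>b. P $ i $ b = 0"
      using pos_semidef_zero_diag insert.prems(1) by blast
    with insert.prems show ?thesis
      by (intro insert.IH) (metis insert_iff)+
  next
    case False
    define P' where "P' = (\<chi> a b. P $ a $ b - P $ a $ i * P $ i $ b / P $ i $ i)"
    have herm: "hermitian P" using insert.prems(1) by (simp add: pos_semidef_def)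
    obtain p where p: "P $ i $ i = of_real p"
      using pos_semidef_diag(1)[OF insert.prems(1)] by (auto elim: Reals_cases)
    then have "p \<ge> 0"
      using pos_semidef_diag(2)[OF insert.prems(1), of i] by simp
    have "pos_semidef P'"
      unfolding P'_def by (rule pos_semidef_schur_complement[OF insert.prems(1) False])
    moreover have "P' $ a $ b = 0" if "a \<notin> S" for a b
      using that False insert.prems(2)[of a] by (cases "a = i") (auto simp: P'_def)
    ultimately have "0 \<le> Re (trace (P' ** Q))"
      by (rule insert.IH)
    moreover have "trace (P ** Q) = trace (P' ** Q) + herm_form Q (column i P) / of_real p"
    proof -
      have "herm_form Q (column i P) = (\<Sum>b\<in>UNIV. \<Sum>a\<in>UNIV. P $ a $ i * P $ i $ b * Q $ b $ a)"
        by (simp add: herm_form_def matrix_vector_mult_def column_def hermitian_entry[OF herm]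
            sum_distrib_left algebra_simps)
      also have "\<dots> = (\<Sum>a\<in>UNIV. \<Sum>b\<in>UNIV. P $ a $ i * P $ i $ b * Q $ b $ a)"
        by (rule sum.swap)
      finally show ?thesis
        by (simp add: trace_mult P'_def p left_diff_distrib sum_subtractf sum_divide_distrib)
    qed
    moreover have "0 \<le> Re (herm_form Q (column i P) / of_real p)"
      using assms(2) \<open>p \<ge> 0\<close> by (simp add: pos_semidef_def Re_divide_of_real)
    ultimately show ?thesis by simp
  qed
qed

lemma trace_pos_semidef_mult_nonneg:
  assumes "pos_semidef P" "pos_semidef Q"
  shows "0 \<le> Re (trace (P ** Q))"
  using trace_pos_semidef_mult_nonneg_support[OF finite[of UNIV] assms(2,1)] by simp

section \<open>Congruence, partial sums and inverses in the Loewner order\<close>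

lemma pos_semidef_congruence:
  assumes "pos_semidef M" "hermitian D"
  shows "pos_semidef (D ** M ** D)"
proof -
  have "herm_form (D ** M ** D) x = herm_form M (D *v x)" for x
    by (simp add: herm_form_cip cip_hermitian[OF assms(2)] matrix_vector_mul_assoc[symmetric])
  moreover have "hermitian (D ** M ** D)"
    using assms by (simp add: pos_semidef_def hermitian_def conj_transpose_mult matrix_mul_assoc)
  ultimately show ?thesis
    using assms by (simp add: pos_semidef_def)
qed

lemma pos_def_imp_pos_semidef: "pos_def M \<Longrightarrow> pos_semidef M"
proof -
  assume M: "pos_def M"
  have "0 \<le> Re (herm_form M x)" for x
    using M by (cases "x = 0") (simp_all add: pos_def_def herm_form_def less_imp_le)
  then show "pos_semidef M"
    using M by (simp add: pos_def_def pos_semidef_def)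
qed

lemma pos_def_add_pos_semidef:
  assumes "pos_def M" "pos_semidef N"
  shows "pos_def (M + N)"
proof -
  have "herm_form (M + N) x = herm_form M x + herm_form N x" for x
    by (simp add: herm_form_cip matrix_vector_mult_add_rdistrib cip_add_right)
  then show ?thesis
    using assms unfolding pos_def_def pos_semidef_def
    by (auto simp: hermitian_add add_pos_nonneg)
qed

text \<open>Definiteness of the first summand passes to every partial sum. This makes all the
  inverses genuine, since \<open>matrix_inv\<close> is a choice operator.\<close>

lemma pos_def_partial_sum:
  fixes A :: "nat \<Rightarrow> complex ^ 'n ^ 'n"
  assumes "1 \<le> k" "pos_def (A 1)" "\<And>j. j \<in> {2..k} \<Longrightarrow> pos_semidef (A j)"
  shows "pos_def (\<Sum>l = 1..k. A l)"
  using assms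
proof (induction k rule: dec_induct)
  case base
  then show ?case by simp
next
  case (step k)
  have "pos_semidef (A (Suc k))"
    by (rule step.prems(2)) (use step.hyps(1) in simp)
  moreover have "pos_def (\<Sum>l = 1..k. A l)"
    by (rule step.IH[OF step.prems(1)], rule step.prems(2)) simp
  ultimately show ?case
    by (simp add: pos_def_add_pos_semidef)
qed

lemma
  assumes "invertible (M :: complex ^ 'n ^ 'm)"
  shows matrix_inv_left: "matrix_inv M ** M = mat 1"
    and matrix_inv_right: "M ** matrix_inv M = mat 1"
  using someI_ex[OF assms[unfolded invertible_def]] by (auto simp: matrix_inv_def)

lemma pos_def_invertible:
  assumes "pos_def M"
  shows "invertible M"
proof -
  have "x = 0" if "M *v x = 0" for x
    using assms that by (force simp: pos_def_def herm_form_def)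
  then show ?thesis
    by (metis invertible_left_inverse matrix_left_invertible_ker)
qed

lemma hermitian_matrix_inv:
  assumes "hermitian M" "invertible M"
  shows "hermitian (matrix_inv M)"
proof -
  have "conj_transpose (matrix_inv M) ** M = conj_transpose (M ** matrix_inv M)"
    using assms(1) by (simp add: conj_transpose_mult hermitian_def)
  also have "\<dots> = mat 1"
    by (simp add: matrix_inv_right assms(2))
  \<comment> \<open>The adjoint of the inverse is a left inverse of \<open>M\<close>; multiplying it
    by \<open>M ** matrix_inv M\<close> identifies it with the right inverse.\<close>
  finally have "conj_transpose (matrix_inv M) ** (M ** matrix_inv M) = matrix_inv M"
    by (simp add: matrix_mul_assoc)
  then show ?thesis
    by (simp add: hermitian_def matrix_inv_right assms(2))
qed

text \<open>The inverse is a congruence of \<open>M\<close> itself: M^-1 = M^-1 M M^-1.\<close>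

lemma pos_semidef_matrix_inv:
  assumes "pos_def M"
  shows "pos_semidef (matrix_inv M)"
proof -
  have inv: "invertible M" and herm: "hermitian M"
    using assms by (auto simp: pos_def_invertible pos_def_def)
  have "matrix_inv M ** M ** matrix_inv M = matrix_inv M"
    by (simp add: inv matrix_inv_left)
  then show ?thesis
    by (metis assms hermitian_matrix_inv herm inv pos_def_imp_pos_semidef pos_semidef_congruence)
qed

text \<open>With \<open>u = X\<inverse> v\<close> and \<open>w = (X + C)\<inverse> v\<close>, the expansion of \<open>(w - u)\<^sup>* X (w - u) \<ge> 0\<close> gives
  \<open>u\<^sup>* X u \<ge> 2 w\<^sup>* (X + C) w - w\<^sup>* X w \<ge> w\<^sup>* (X + C) w\<close>.\<close>

lemma matrix_inv_antimono:
  assumes "pos_def X" "pos_semidef C"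
  shows "pos_semidef (matrix_inv X - matrix_inv (X + C))"
proof -
  have Z: "pos_def (X + C)"
    using assms by (rule pos_def_add_pos_semidef)
  have hX: "hermitian X" and hZ: "hermitian (X + C)"
    using assms(1) Z by (auto simp: pos_def_def)
  have iX: "invertible X" and iZ: "invertible (X + C)"
    using assms(1) Z by (auto simp: pos_def_invertible)
  have "0 \<le> Re (herm_form (matrix_inv X - matrix_inv (X + C)) v)" for v
  proof -
    define u where "u = matrix_inv X *v v"
    define w where "w = matrix_inv (X + C) *v v"
    have u: "X *v u = v"
      by (simp add: u_def matrix_vector_mul_assoc iX matrix_inv_right)
    have w: "X *v w + C *v w = v"
      by (metis iZ matrix_inv_right matrix_vector_mul_assoc matrix_vector_mul_lid
          matrix_vector_mult_add_rdistrib w_def)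
    have "0 \<le> Re (herm_form X (w - u))"
      using assms(1) pos_def_imp_pos_semidef pos_semidef_def by blast
    also have "herm_form X (w - u) = cip w (X *v w) - cip w v - cip u (X *v w) + cip u v"
      by (simp add: herm_form_cip matrix_vector_mult_diff_distrib cip_diff_left cip_diff_right u)
    also have "cip u (X *v w) = cip v w"
      by (simp add: cip_hermitian[OF hX] u)
    finally have "0 \<le> Re (cip w (X *v w)) - Re (cip w v) - Re (cip v w) + Re (cip u v)"
      by simp
    moreover have "0 \<le> Re (cip w (C *v w))"
      using assms(2) by (simp add: pos_semidef_def herm_form_cip)
    moreover have "Re (cip w v) = Re (cip w (X *v w)) + Re (cip w (C *v w))"
      by (metis cip_add_right plus_complex.simps(1) w)
    moreover have "Re (cip u v) = Re (cip v u)"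
      by (metis cnj_cip cnj.simps(1))
    moreover have "herm_form (matrix_inv X - matrix_inv (X + C)) v = cip v u - cip v w"
      by (simp add: herm_form_cip matrix_vector_mult_diff_rdistrib cip_diff_right u_def w_def)
    ultimately show ?thesis by simp
  qed
  then show ?thesis
    using hX hZ iX iZ by (simp add: pos_semidef_def hermitian_diff hermitian_matrix_inv)
qed

section \<open>The quadratic form of the partial sums and its one-step estimate\<close>

definition energy :: "complex ^ 'n ^ 'n \<Rightarrow> complex ^ 'n ^ 'n \<Rightarrow> complex ^ 'n ^ 'n \<Rightarrow> real" where
  "energy Y X D = Re (trace (D ** matrix_inv Y ** D ** matrix_inv X))"

lemma energy_nonneg:
  assumes "pos_def X" "pos_def Y" "hermitian D"
  shows "0 \<le> energy Y X D"
  unfolding energy_def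
  by (intro trace_pos_semidef_mult_nonneg pos_semidef_congruence pos_semidef_matrix_inv assms)

lemma matrix_sub_ldistrib: "(M :: complex ^ 'n ^ 'm) ** (N - P) = M ** N - M ** P"
  by (simp add: vec_eq_iff matrix_matrix_mult_def right_diff_distrib sum_subtractf)

lemma matrix_sub_rdistrib: "(N - P) ** (M :: complex ^ 'n ^ 'm) = N ** M - P ** M"
  by (simp add: vec_eq_iff matrix_matrix_mult_def left_diff_distrib sum_subtractf)

text \<open>The inverses are replaced one at a time, passing through the mixed term with
  \<open>Y\<close> and \<open>X + A\<close>. Each change is the trace of a product of two positive
  semidefinite matrices.\<close>

lemma energy_antimono:
  assumes "pos_def X" "pos_def Y" "pos_semidef A" "pos_semidef B" "hermitian D"
  shows "energy (Y + B) (X + A) D \<le> energy Y X D"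
proof -
  have "0 \<le> Re (trace (D ** (matrix_inv Y - matrix_inv (Y + B)) ** D ** matrix_inv (X + A)))"
    by (intro trace_pos_semidef_mult_nonneg pos_semidef_congruence pos_semidef_matrix_inv
        matrix_inv_antimono pos_def_add_pos_semidef assms)
  moreover have "0 \<le> Re (trace (D ** matrix_inv Y ** D ** (matrix_inv X - matrix_inv (X + A))))"
    by (intro trace_pos_semidef_mult_nonneg pos_semidef_congruence pos_semidef_matrix_inv
        matrix_inv_antimono assms)
  ultimately show ?thesis
    by (simp add: energy_def matrix_sub_ldistrib matrix_sub_rdistrib trace_sub)
qed

lemma matrix_inv_diff:
  assumes "pos_def X" "pos_def Y"
  shows "matrix_inv Y - matrix_inv X = matrix_inv Y ** (X - Y) ** matrix_inv X"
  using assms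
  by (simp add: matrix_sub_ldistrib matrix_sub_rdistrib pos_def_invertible matrix_inv_left
      matrix_inv_right matrix_mul_assoc[symmetric])

text \<open>Cauchy--Schwarz for the form \<open>(P, Q) \<mapsto> Tr (P Y\<inverse> Q X\<inverse>)\<close>.\<close>

lemma energy_cross_le:
  assumes "pos_def X" "pos_def Y" "hermitian P" "hermitian Q"
  shows "2 * Re (trace (P ** matrix_inv Y ** Q ** matrix_inv X)) \<le> energy Y X P + energy Y X Q"
proof -
  have hX: "hermitian (matrix_inv X)" and hY: "hermitian (matrix_inv Y)"
    using assms pos_semidef_matrix_inv pos_semidef_def by blast+
  \<comment> \<open>Conjugation reverses the product and cyclicity then exchanges \<open>P\<close>
    and \<open>Q\<close>, so the two cross terms in the energy of \<open>P - Q\<close> have the same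
    real part.\<close>
  have "cnj (trace (P ** matrix_inv Y ** Q ** matrix_inv X))
      = trace (matrix_inv X ** (Q ** matrix_inv Y ** P))"
    using assms hX hY
    by (simp add: trace_conj_transpose[symmetric] conj_transpose_mult hermitian_def matrix_mul_assoc)
  also have "\<dots> = trace (Q ** matrix_inv Y ** P ** matrix_inv X)"
    by (rule trace_mul_sym)
  finally have "Re (trace (Q ** matrix_inv Y ** P ** matrix_inv X))
      = Re (trace (P ** matrix_inv Y ** Q ** matrix_inv X))"
    by (metis cnj.simps(1))
  moreover have "0 \<le> energy Y X (P - Q)"
    using assms by (intro energy_nonneg hermitian_diff)
  ultimately show ?thesis
    by (simp add: energy_def matrix_sub_ldistrib matrix_sub_rdistrib trace_sub)
qed

text \<open>With old gap D and new gap E, the right-hand side is 2<E,E> - 2 Re<D,E> in the new form.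
  Cauchy-Schwarz bounds this below by <E,E> - <D,D>, and antitonicity replaces the new <D,D> by the
  larger old one.\<close>

lemma energy_step:
  assumes "pos_def X" "pos_def Y" "pos_semidef A" "pos_semidef B"
  shows "energy (Y + B) (X + A) (X + A - (Y + B)) - energy Y X (X - Y)
    \<le> 2 * Re (trace ((A - B) ** (matrix_inv (Y + B) - matrix_inv (X + A))))"
proof -
  define D where "D = X - Y"
  define E where "E = X + A - (Y + B)"
  have pd: "pos_def (X + A)" "pos_def (Y + B)"
    using assms by (auto intro: pos_def_add_pos_semidef)
  have hD: "hermitian D" and hE: "hermitian E"
    using assms pd by (auto simp: D_def E_def pos_def_def intro: hermitian_diff)
  have "A - B = E - D"
    by (simp add: D_def E_def)
  then have "Re (trace ((A - B) ** (matrix_inv (Y + B) - matrix_inv (X + A))))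
      = energy (Y + B) (X + A) E
        - Re (trace (D ** matrix_inv (Y + B) ** E ** matrix_inv (X + A)))"
    by (simp add: matrix_inv_diff[OF pd] E_def[symmetric] matrix_sub_rdistrib trace_sub
        energy_def matrix_mul_assoc)
  then show ?thesis
    using energy_cross_le[OF pd hD hE] energy_antimono[OF assms hD]
    by (simp add: D_def[symmetric] E_def[symmetric])
qed

section \<open>Telescoping over the index\<close>

lemma trace_sum: "trace (\<Sum>k\<in>S. f k) = (\<Sum>k\<in>S. trace (f k :: complex ^ 'n ^ 'n))"
  by (simp add: trace_def) (rule sum.swap)

theorem theorem1p1:
  fixes K :: nat and A B :: "nat \<Rightarrow> complex ^ 'n ^ 'n"
  assumes "K \<ge> 1"
    and "pos_def (A 1)" and "pos_def (B 1)"
    and "\<And>k. k \<in> {2..K} \<Longrightarrow> pos_semidef (A k)"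
    and "\<And>k. k \<in> {2..K} \<Longrightarrow> pos_semidef (B k)"
  shows "trace (\<Sum>k = 1..K. (A k - B k) **
            (matrix_inv (\<Sum>l = 1..k. B l) - matrix_inv (\<Sum>l = 1..k. A l))) \<in> \<real>
    \<and> 0 \<le> Re (trace (\<Sum>k = 1..K. (A k - B k) **
            (matrix_inv (\<Sum>l = 1..k. B l) - matrix_inv (\<Sum>l = 1..k. A l))))"
proof -
  define X where "X k = (\<Sum>l = 1..k. A l)" for k
  define Y where "Y k = (\<Sum>l = 1..k. B l)" for k
  define T where "T k = trace ((A k - B k) ** (matrix_inv (Y k) - matrix_inv (X k)))" for k
  have X: "pos_def (X k)" if "1 \<le> k" "k \<le> K" for k
    unfolding X_def using that(1) assms(2)
    by (rule pos_def_partial_sum) (use that(2) assms(4) in simp)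
  have Y: "pos_def (Y k)" if "1 \<le> k" "k \<le> K" for k
    unfolding Y_def using that(1) assms(3)
    by (rule pos_def_partial_sum) (use that(2) assms(5) in simp)
  have hXY: "hermitian (X k)" "hermitian (Y k)" if "1 \<le> k" "k \<le> K" for k
    using X[OF that] Y[OF that] by (simp_all add: pos_def_def)
  have hAB: "hermitian (A k)" "hermitian (B k)" if k: "k \<in> {1..K}" for k
  proof -
    consider "k = 1" | "k \<in> {2..K}" using k by fastforce
    then show "hermitian (A k)" "hermitian (B k)"
      using assms(2-5)[unfolded pos_def_def pos_semidef_def] by (cases; blast)+
  qed
  have "T k \<in> \<real>" if k: "k \<in> {1..K}" for k
  proof -
    have "1 \<le> k" "k \<le> K" using k by simp_all
    then show ?thesis
      unfolding T_def
      by (intro trace_hermitian_mult_real hermitian_diff hermitian_matrix_inv hAB[OF k]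
          hXY pos_def_invertible X Y)
  qed
  then have real: "(\<Sum>k = 1..K. T k) \<in> \<real>"
    by (rule sum_in_Reals)
  \<comment> \<open>The induction carries the current energy as a lower bound, because the next step
    subtracts exactly that energy; nonnegativity of the partial sum alone would not
    propagate.\<close>
  have "energy (Y k) (X k) (X k - Y k) \<le> 2 * Re (\<Sum>l = 1..k. T l)" if "1 \<le> k" "k \<le> K" for k
    using that
  proof (induction k rule: dec_induct)
    case base
    \<comment> \<open>The gap before the first index is zero, so the first term is the full energy
      and, being nonnegative, is at most its double.\<close>
    have "T 1 = trace ((X 1 - Y 1) ** matrix_inv (Y 1) ** (X 1 - Y 1) ** matrix_inv (X 1))"
      using matrix_inv_diff[OF assms(2,3)] by (simp add: T_def X_def Y_def matrix_mul_assoc)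
    moreover have "0 \<le> energy (Y 1) (X 1) (X 1 - Y 1)"
      using base by (intro energy_nonneg hermitian_diff X Y hXY) simp_all
    ultimately show ?case by (simp add: energy_def)
  next
    case (step k)
    have "X (Suc k) = X k + A (Suc k)" "Y (Suc k) = Y k + B (Suc k)"
      by (simp_all add: X_def Y_def)
    moreover have k: "k \<le> K" "Suc k \<in> {2..K}"
      using step.prems step.hyps(1) by simp_all
    ultimately have "energy (Y (Suc k)) (X (Suc k)) (X (Suc k) - Y (Suc k))
          - energy (Y k) (X k) (X k - Y k) \<le> 2 * Re (T (Suc k))"
      using energy_step[OF X[OF step.hyps(1) k(1)] Y[OF step.hyps(1) k(1)] assms(4,5)[OF k(2)]]
      by (simp only: T_def add_diff_cancel_left')
    moreover have "energy (Y k) (X k) (X k - Y k) \<le> 2 * Re (\<Sum>l = 1..k. T l)"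
      using step.IH k(1) .
    ultimately show ?case by simp
  qed
  then have "energy (Y K) (X K) (X K - Y K) \<le> 2 * Re (\<Sum>k = 1..K. T k)"
    using assms(1) by blast
  moreover have "0 \<le> energy (Y K) (X K) (X K - Y K)"
    by (intro energy_nonneg hermitian_diff X Y hXY assms(1) order_refl)
  ultimately have "0 \<le> Re (\<Sum>k = 1..K. T k)"
    by linarith
  with real show ?thesis
    unfolding trace_sum T_def X_def Y_def ..
qed

end
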